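(* The canonical model $\mathcal{M}^c=(W^c,\sim^c,V^c)$ for $\mathsf{Syn}$ is a proper $\kappa$-model.
   Context: Fix a finite set $\mathsf{Ag}$ of agents; an agent pattern is a set $G\subseteq\mathcal{P}(\mathsf{Ag})\setminus\{\emptyset\}$. Formulas: $\varphi::= p\mid\neg\varphi\mid\varphi\wedge\varphi\mid [G]\varphi$ ($p$ in a countable set $\mathsf{Prop}$); $\bot:=p\wedge\neg p$ for fixed $p$; $\mathsf{alive}(G):=\neg[G]\bot$; $G^C:=\{H\in\mathcal{P}(\mathsf{Ag})\setminus\{\emptyset\}\mid\neg\exists B\in G.\ H\subseteq B\}$; $\mathsf{dead}(G):=\bigwedge_{B\in G}\neg\mathsf{alive}(\{B\})$. $\mathsf{Syn}$: all propositional tautologies; (K) $[G](\varphi\to\psi)\to([G]\varphi\to[G]\psi)$; (B) $\varphi\to[G]\neg[G]\neg\varphi$; (4) $[G]\varphi\to[G][G]\varphi$; (T) $\mathsf{alive}(G)\to([G]\varphi\to\varphi)$; (P) $\mathsf{alive}(G)\wedge\mathsf{dead}(G^C)\wedge\varphi\to[G](\mathsf{dead}(G^C)\to\varphi)$; (NE) $\bigvee_G\mathsf{alive}(G)$; (Mono) $[G]\varphi\to[H]\varphi$ if $G\subseteq H$; (Equiv) $[G\cup\{B\}]\varphi\to[G]\varphi$ if some $A\in G$ has $\emptyset\ne B\subseteq A$; (Union) $\mathsf{alive}(G)\wedge\mathsf{alive}(H)\to\mathsf{alive}(G\cup H)$; (Clo) $\mathsf{alive}(G)\to\mathsf{alive}(\{A\cup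 B\})$ for $A,B\in G$; rules modus ponens and $[G]$-necessitation. A set $\Gamma$ of formulas is consistent if $\Gamma\not\vdash\bot$ in $\mathsf{Syn}$, and maximal consistent if no proper superset is consistent. Canonical model: $W^c$ is the set of maximal consistent sets; $\Gamma\sim^c_G\Delta$ iff $\{\varphi\mid[G]\varphi\in\Gamma\}\subseteq\Delta$; $\Gamma\in V^c(p)$ iff $p\in\Gamma$. A pre-model $\mathcal{M}=(W,\sim,V)$: $W$ a set, $\sim_G$ a symmetric transitive relation on $W$ for each agent pattern $G$, $V$ a valuation. $\mathsf{alive}(G)_\mathcal{M}=\{w\mid w\sim_G w\}$. A $\kappa$-model is a pre-model with, for all agent patterns $G,H$: (K1) $\mathsf{alive}(G)_\mathcal{M}\cap\mathsf{alive}(H)_\mathcal{M}\subseteq\mathsf{alive}(G\cup H)_\mathcal{M}$; (K2) $\mathsf{alive}(G)_\mathcal{M}\subseteq\mathsf{alive}(\{A\cup B\})_\mathcal{M}$ for $A,B\in G$; (K3) $\sim_H\subseteq\sim_G$ if $G\subseteq H$; (K4) $\sim_G\subseteq\sim_{G\cup\{B\}}$ if some $A\in G$ has $\emptyset\ne B\subseteq A$; (NE) every $w$ has some $G$ with $w\sim_G w$. For $w\in W$ let $\overline{w}=\{B\mid\exists G.\ B\in G\text{ and }w\in\mathsf{alive}(G)_\mathcal{M}\}$. Define $w\equiv v$ iff $\overline{w}=\overline{v}$ and $w\sim_{\overline{w}}v$. $\mathcal{M}$ is proper iff $w\equiv v$ implies $w=v$. *)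

theory Defs
  imports Main "HOL-Library.Countable"
begin

section \<open>Syntax\<close>

definition agent_pattern :: "'a set \<Rightarrow> 'a set set \<Rightarrow> bool" where
  "agent_pattern Ag G \<longleftrightarrow> G \<subseteq> Pow Ag - {{}}"

datatype ('a, 'p) fm =
    Atom 'p
  | Neg "('a, 'p) fm"
  | Conj "('a, 'p) fm" "('a, 'p) fm"
  | Box "'a set set" "('a, 'p) fm"

text \<open>The datatype admits arbitrary sets of sets as box indices; the formulas of the language are
  those in which every index is an agent pattern over \<open>Ag\<close>.\<close>

primrec is_formula :: "'a set \<Rightarrow> ('a, 'p) fm \<Rightarrow> bool" where
  "is_formula Ag (Atom p) \<longleftrightarrow> True"
| "is_formula Ag (Neg \<phi>) \<longleftrightarrow> is_formula Ag \<phi>"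
| "is_formula Ag (Conj \<phi> \<psi>) \<longleftrightarrow> is_formula Ag \<phi> \<and> is_formula Ag \<psi>"
| "is_formula Ag (Box G \<phi>) \<longleftrightarrow> agent_pattern Ag G \<and> is_formula Ag \<phi>"

definition Imp :: "('a, 'p) fm \<Rightarrow> ('a, 'p) fm \<Rightarrow> ('a, 'p) fm" where
  "Imp \<phi> \<psi> = Neg (Conj \<phi> (Neg \<psi>))"

definition Disj :: "('a, 'p) fm \<Rightarrow> ('a, 'p) fm \<Rightarrow> ('a, 'p) fm" where
  "Disj \<phi> \<psi> = Neg (Conj (Neg \<phi>) (Neg \<psi>))"

text \<open>The parameter \<open>p\<^sub>0\<close>, here and below, is the fixed proposition used to define falsity.\<close>

definition Bot :: "'p \<Rightarrow> ('a, 'p) fm" where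
  "Bot p\<^sub>0 = Conj (Atom p\<^sub>0) (Neg (Atom p\<^sub>0))"

definition Top :: "'p \<Rightarrow> ('a, 'p) fm" where
  "Top p\<^sub>0 = Neg (Bot p\<^sub>0)"

definition conj_list :: "'p \<Rightarrow> ('a, 'p) fm list \<Rightarrow> ('a, 'p) fm" where
  "conj_list p\<^sub>0 \<phi>s = foldr Conj \<phi>s (Top p\<^sub>0)"

definition disj_list :: "'p \<Rightarrow> ('a, 'p) fm list \<Rightarrow> ('a, 'p) fm" where
  "disj_list p\<^sub>0 \<phi>s = foldr Disj \<phi>s (Bot p\<^sub>0)"

text \<open>Conjunctions and disjunctions indexed by a finite set are formed along an arbitrary but fixed
  enumeration of that set.\<close>

definition enumeration :: "'b set \<Rightarrow> 'b list" where
  "enumeration A = (SOME xs. set xs = A \<and> distinct xs)"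

definition alive :: "'p \<Rightarrow> 'a set set \<Rightarrow> ('a, 'p) fm" where
  "alive p\<^sub>0 G = Neg (Box G (Bot p\<^sub>0))"

definition dead :: "'p \<Rightarrow> 'a set set \<Rightarrow> ('a, 'p) fm" where
  "dead p\<^sub>0 G = conj_list p\<^sub>0 (map (\<lambda>B. Neg (alive p\<^sub>0 {B})) (enumeration G))"

definition pattern_compl :: "'a set \<Rightarrow> 'a set set \<Rightarrow> 'a set set" where
  "pattern_compl Ag G = {H \<in> Pow Ag - {{}}. \<not> (\<exists>B\<in>G. H \<subseteq> B)}"


section \<open>The axiom system\<close>

text \<open>Propositional evaluation treats atoms and boxed formulas as propositional variables, so a
  tautology is any formula that is a substitution instance of a classical tautology.\<close>

primrec prop_eval :: "(('a, 'p) fm \<Rightarrow> bool) \<Rightarrow> ('a, 'p) fm \<Rightarrow> bool" where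
  "prop_eval v (Atom p) \<longleftrightarrow> v (Atom p)"
| "prop_eval v (Neg \<phi>) \<longleftrightarrow> \<not> prop_eval v \<phi>"
| "prop_eval v (Conj \<phi> \<psi>) \<longleftrightarrow> prop_eval v \<phi> \<and> prop_eval v \<psi>"
| "prop_eval v (Box G \<phi>) \<longleftrightarrow> v (Box G \<phi>)"

definition tautology :: "('a, 'p) fm \<Rightarrow> bool" where
  "tautology \<phi> \<longleftrightarrow> (\<forall>v. prop_eval v \<phi>)"

inductive Syn :: "'a set \<Rightarrow> 'p \<Rightarrow> ('a, 'p) fm \<Rightarrow> bool" for Ag :: "'a set" and p\<^sub>0 :: 'p where
  Taut: "is_formula Ag \<phi> \<Longrightarrow> tautology \<phi> \<Longrightarrow> Syn Ag p\<^sub>0 \<phi>"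
| K: "agent_pattern Ag G \<Longrightarrow> is_formula Ag \<phi> \<Longrightarrow> is_formula Ag \<psi> \<Longrightarrow>
    Syn Ag p\<^sub>0 (Imp (Box G (Imp \<phi> \<psi>)) (Imp (Box G \<phi>) (Box G \<psi>)))"
| B: "agent_pattern Ag G \<Longrightarrow> is_formula Ag \<phi> \<Longrightarrow>
    Syn Ag p\<^sub>0 (Imp \<phi> (Box G (Neg (Box G (Neg \<phi>)))))"
| Four: "agent_pattern Ag G \<Longrightarrow> is_formula Ag \<phi> \<Longrightarrow>
    Syn Ag p\<^sub>0 (Imp (Box G \<phi>) (Box G (Box G \<phi>)))"
| T: "agent_pattern Ag G \<Longrightarrow> is_formula Ag \<phi> \<Longrightarrow>
    Syn Ag p\<^sub>0 (Imp (alive p\<^sub>0 G) (Imp (Box G \<phi>) \<phi>))"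
| P: "agent_pattern Ag G \<Longrightarrow> is_formula Ag \<phi> \<Longrightarrow>
    Syn Ag p\<^sub>0 (Imp (Conj (alive p\<^sub>0 G) (Conj (dead p\<^sub>0 (pattern_compl Ag G)) \<phi>))
                    (Box G (Imp (dead p\<^sub>0 (pattern_compl Ag G)) \<phi>)))"
| NE: "Syn Ag p\<^sub>0 (disj_list p\<^sub>0 (map (alive p\<^sub>0) (enumeration {G. agent_pattern Ag G})))"
| Mono: "agent_pattern Ag G \<Longrightarrow> agent_pattern Ag H \<Longrightarrow> is_formula Ag \<phi> \<Longrightarrow> G \<subseteq> H \<Longrightarrow>
    Syn Ag p\<^sub>0 (Imp (Box G \<phi>) (Box H \<phi>))"
| Equiv: "agent_pattern Ag G \<Longrightarrow> is_formula Ag \<phi> \<Longrightarrow> A \<in> G \<Longrightarrow> B \<noteq> {} \<Longrightarrow> B \<subseteq> A \<Longrightarrow>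
    Syn Ag p\<^sub>0 (Imp (Box (G \<union> {B}) \<phi>) (Box G \<phi>))"
| Union: "agent_pattern Ag G \<Longrightarrow> agent_pattern Ag H \<Longrightarrow>
    Syn Ag p\<^sub>0 (Imp (Conj (alive p\<^sub>0 G) (alive p\<^sub>0 H)) (alive p\<^sub>0 (G \<union> H)))"
| Clo: "agent_pattern Ag G \<Longrightarrow> A \<in> G \<Longrightarrow> B \<in> G \<Longrightarrow>
    Syn Ag p\<^sub>0 (Imp (alive p\<^sub>0 G) (alive p\<^sub>0 {A \<union> B}))"
| MP: "Syn Ag p\<^sub>0 (Imp \<phi> \<psi>) \<Longrightarrow> Syn Ag p\<^sub>0 \<phi> \<Longrightarrow> Syn Ag p\<^sub>0 \<psi>"
| Nec: "agent_pattern Ag G \<Longrightarrow> Syn Ag p\<^sub>0 \<phi> \<Longrightarrow> Syn Ag p\<^sub>0 (Box G \<phi>)"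

text \<open>Derivability from premises is local, as usual for modal logics: necessitation applies to
  theorems only.\<close>

definition derives :: "'a set \<Rightarrow> 'p \<Rightarrow> ('a, 'p) fm set \<Rightarrow> ('a, 'p) fm \<Rightarrow> bool" where
  "derives Ag p\<^sub>0 \<Gamma> \<phi> \<longleftrightarrow> (\<exists>\<psi>s. set \<psi>s \<subseteq> \<Gamma> \<and> Syn Ag p\<^sub>0 (Imp (conj_list p\<^sub>0 \<psi>s) \<phi>))"

definition consistent :: "'a set \<Rightarrow> 'p \<Rightarrow> ('a, 'p) fm set \<Rightarrow> bool" where
  "consistent Ag p\<^sub>0 \<Gamma> \<longleftrightarrow> \<Gamma> \<subseteq> {\<phi>. is_formula Ag \<phi>} \<and> \<not> derives Ag p\<^sub>0 \<Gamma> (Bot p\<^sub>0)"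

definition maximal_consistent :: "'a set \<Rightarrow> 'p \<Rightarrow> ('a, 'p) fm set \<Rightarrow> bool" where
  "maximal_consistent Ag p\<^sub>0 \<Gamma> \<longleftrightarrow>
     consistent Ag p\<^sub>0 \<Gamma> \<and> (\<forall>\<Delta>. \<Gamma> \<subset> \<Delta> \<longrightarrow> \<not> consistent Ag p\<^sub>0 \<Delta>)"


section \<open>Models\<close>

record ('a, 'p, 'w) model =
  worlds :: "'w set"
  indist :: "'a set set \<Rightarrow> 'w rel"
  valuation :: "'p \<Rightarrow> 'w set"

definition pre_model :: "'a set \<Rightarrow> ('a, 'p, 'w) model \<Rightarrow> bool" where
  "pre_model Ag M \<longleftrightarrow>
     (\<forall>G. agent_pattern Ag G \<longrightarrow>
        indist M G \<subseteq> worlds M \<times> worlds M \<and> sym (indist M G) \<and> trans (indist M G)) \<and>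
     (\<forall>p. valuation M p \<subseteq> worlds M)"

definition alive_worlds :: "('a, 'p, 'w) model \<Rightarrow> 'a set set \<Rightarrow> 'w set" where
  "alive_worlds M G = {w \<in> worlds M. (w, w) \<in> indist M G}"

definition kappa_model :: "'a set \<Rightarrow> ('a, 'p, 'w) model \<Rightarrow> bool" where
  "kappa_model Ag M \<longleftrightarrow> pre_model Ag M \<and>
     (\<forall>G H. agent_pattern Ag G \<longrightarrow> agent_pattern Ag H \<longrightarrow>
        alive_worlds M G \<inter> alive_worlds M H \<subseteq> alive_worlds M (G \<union> H)) \<and>
     (\<forall>G. agent_pattern Ag G \<longrightarrow>
        (\<forall>A\<in>G. \<forall>B\<in>G. alive_worlds M G \<subseteq> alive_worlds M {A \<union> B})) \<and>
     (\<forall>G H. agent_pattern Ag G \<longrightarrow> agent_pattern Ag H \<longrightarrow> G \<subseteq> H \<longrightarrow>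
        indist M H \<subseteq> indist M G) \<and>
     (\<forall>G B. agent_pattern Ag G \<longrightarrow> (\<exists>A\<in>G. B \<noteq> {} \<and> B \<subseteq> A) \<longrightarrow>
        indist M G \<subseteq> indist M (G \<union> {B})) \<and>
     (\<forall>w\<in>worlds M. \<exists>G. agent_pattern Ag G \<and> (w, w) \<in> indist M G)"

definition alive_sets :: "'a set \<Rightarrow> ('a, 'p, 'w) model \<Rightarrow> 'w \<Rightarrow> 'a set set" where
  "alive_sets Ag M w = {B. \<exists>G. agent_pattern Ag G \<and> B \<in> G \<and> w \<in> alive_worlds M G}"

definition world_equiv :: "'a set \<Rightarrow> ('a, 'p, 'w) model \<Rightarrow> 'w \<Rightarrow> 'w \<Rightarrow> bool" where
  "world_equiv Ag M w v \<longleftrightarrow>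
     alive_sets Ag M w = alive_sets Ag M v \<and> (w, v) \<in> indist M (alive_sets Ag M w)"

definition proper :: "'a set \<Rightarrow> ('a, 'p, 'w) model \<Rightarrow> bool" where
  "proper Ag M \<longleftrightarrow> (\<forall>w\<in>worlds M. \<forall>v\<in>worlds M. world_equiv Ag M w v \<longrightarrow> w = v)"

definition canonical_model :: "'a set \<Rightarrow> 'p \<Rightarrow> ('a, 'p, ('a, 'p) fm set) model" where
  "canonical_model Ag p\<^sub>0 =
     \<lparr>worlds = {\<Gamma>. maximal_consistent Ag p\<^sub>0 \<Gamma>},
      indist = (\<lambda>G. {(\<Gamma>, \<Delta>). maximal_consistent Ag p\<^sub>0 \<Gamma> \<and> maximal_consistent Ag p\<^sub>0 \<Delta> \<and>
                             {\<phi>. Box G \<phi> \<in> \<Gamma>} \<subseteq> \<Delta>}),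
      valuation = (\<lambda>p. {\<Gamma>. maximal_consistent Ag p\<^sub>0 \<Gamma> \<and> Atom p \<in> \<Gamma>})\<rparr>"

end

theory Submission
  imports Defs
begin

text \<open>
  Each frame condition of the canonical model is the set-theoretic reading of one axiom, because a
  maximal consistent set \<open>\<Gamma>\<close> satisfies \<open>\<Gamma> \<sim>\<^sub>G \<Gamma>\<close> exactly when it contains \<open>alive(G)\<close>: axiom (T) gives
  one direction, and \<open>\<bottom> \<notin> \<Gamma>\<close> the other. For properness let \<open>D\<close> be the common pattern of two equivalent
  worlds \<open>\<Gamma>\<close> and \<open>\<Delta>\<close>. Both contain \<open>dead(D\<^sup>C)\<close>, and \<open>\<Gamma>\<close> contains \<open>alive(D)\<close>, so axiom (P) transports
  every member of \<open>\<Gamma>\<close> along \<open>\<sim>\<^sub>D\<close> into \<open>\<Delta>\<close>; maximality turns the inclusion into an equality. No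
  Lindenbaum lemma is needed, since no world has to be constructed.
\<close>

section \<open>Enumerations, well-formedness and propositional evaluation\<close>

lemma set_enumeration:
  assumes "finite A"
  shows "set (enumeration A) = A"
  unfolding enumeration_def
  using someI_ex[OF finite_distinct_list[OF assms]] by blast

lemma finite_agent_patterns: "finite Ag \<Longrightarrow> finite {G. agent_pattern Ag G}"
  by (auto simp: agent_pattern_def)

lemma finite_pattern_compl: "finite Ag \<Longrightarrow> finite (pattern_compl Ag G)"
  by (auto simp: pattern_compl_def)

lemma agent_pattern_Un [simp]:
  "agent_pattern Ag (G \<union> H) \<longleftrightarrow> agent_pattern Ag G \<and> agent_pattern Ag H"
  by (auto simp: agent_pattern_def)

lemma is_formula_Imp [simp]: "is_formula Ag (Imp \<phi> \<psi>) \<longleftrightarrow> is_formula Ag \<phi> \<and> is_formula Ag \<psi>"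
  by (simp add: Imp_def)

lemma is_formula_Bot [simp]: "is_formula Ag (Bot p\<^sub>0)"
  by (simp add: Bot_def)

lemma is_formula_alive [simp]: "is_formula Ag (alive p\<^sub>0 G) \<longleftrightarrow> agent_pattern Ag G"
  by (simp add: alive_def)

lemma is_formula_conj_list [simp]:
  "is_formula Ag (conj_list p\<^sub>0 \<phi>s) \<longleftrightarrow> (\<forall>\<phi>\<in>set \<phi>s. is_formula Ag \<phi>)"
  by (induction \<phi>s) (auto simp: conj_list_def Top_def)

lemma is_formula_disj_list [simp]:
  "is_formula Ag (disj_list p\<^sub>0 \<phi>s) \<longleftrightarrow> (\<forall>\<phi>\<in>set \<phi>s. is_formula Ag \<phi>)"
  by (induction \<phi>s) (auto simp: disj_list_def Disj_def)

text \<open>\<open>enumeration\<close> chooses its list by \<open>SOME\<close>, so its members are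
  known only for a finite set. Finiteness of \<open>Ag\<close> provides this for the complement,
  whose members are nonempty subsets of \<open>Ag\<close> and so give singleton agent
  patterns.\<close>

lemma is_formula_dead_compl:
  "finite Ag \<Longrightarrow> is_formula Ag (dead p\<^sub>0 (pattern_compl Ag G))"
  by (auto simp: dead_def set_enumeration finite_pattern_compl pattern_compl_def agent_pattern_def)

lemma prop_eval_Imp [simp]: "prop_eval v (Imp \<phi> \<psi>) \<longleftrightarrow> (prop_eval v \<phi> \<longrightarrow> prop_eval v \<psi>)"
  by (simp add: Imp_def)

lemma prop_eval_Bot [simp]: "\<not> prop_eval v (Bot p\<^sub>0)"
  by (simp add: Bot_def)

lemma prop_eval_conj_list [simp]:
  "prop_eval v (conj_list p\<^sub>0 \<phi>s) \<longleftrightarrow> (\<forall>\<phi>\<in>set \<phi>s. prop_eval v \<phi>)"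
  by (induction \<phi>s) (auto simp: conj_list_def Top_def)

section \<open>Derived rules for theorems\<close>

lemma Syn_is_formula:
  assumes "finite Ag" "Syn Ag p\<^sub>0 \<phi>"
  shows "is_formula Ag \<phi>"
  using assms(2)
proof (induction rule: Syn.induct)
  case NE
  show ?case
    by (simp add: set_enumeration finite_agent_patterns[OF assms(1)])
next
  case (Equiv G \<phi> A B)
  then show ?case
    by (auto simp: agent_pattern_def)
next
  case (Clo G A B)
  then show ?case
    by (auto simp: agent_pattern_def)
qed (auto simp: is_formula_dead_compl[OF assms(1)])

text \<open>Reduces propositional reasoning between theorems to a check on \<open>prop_eval\<close>:
  the nested implication is a tautology and \<open>MP\<close> detaches it twice. A single premise
  can be supplied in both places.\<close>

lemma Syn_tautological_consequence:
  assumes "Syn Ag p\<^sub>0 \<phi>" "Syn Ag p\<^sub>0 \<psi>"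
    and "is_formula Ag \<phi>" "is_formula Ag \<psi>" "is_formula Ag \<chi>"
    and "\<And>v. prop_eval v \<phi> \<Longrightarrow> prop_eval v \<psi> \<Longrightarrow> prop_eval v \<chi>"
  shows "Syn Ag p\<^sub>0 \<chi>"
proof -
  have "Syn Ag p\<^sub>0 (Imp \<phi> (Imp \<psi> \<chi>))"
    using assms(3-6) by (intro Syn.Taut) (auto simp: tautology_def)
  then show ?thesis
    using assms(1,2) by (blast intro: Syn.MP)
qed

text \<open>Necessitation followed by axiom \<open>K\<close>; it allows rewriting under a
  box.\<close>

lemma Syn_Box_mono:
  assumes "agent_pattern Ag G" "is_formula Ag \<phi>" "is_formula Ag \<psi>" "Syn Ag p\<^sub>0 (Imp \<phi> \<psi>)"
  shows "Syn Ag p\<^sub>0 (Imp (Box G \<phi>) (Box G \<psi>))"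
  using assms by (blast intro: Syn.MP Syn.K Syn.Nec)

section \<open>Maximal consistent sets\<close>

lemma maximal_consistent_is_formula:
  "maximal_consistent Ag p\<^sub>0 \<Gamma> \<Longrightarrow> \<phi> \<in> \<Gamma> \<Longrightarrow> is_formula Ag \<phi>"
  by (auto simp: maximal_consistent_def consistent_def)

text \<open>By maximality \<open>insert \<phi> \<Gamma>\<close> derives falsity; discharging \<phi>
  from the premises, as in the deduction theorem, leaves a derivation of its negation from \<Gamma>
  alone.\<close>

lemma maximal_consistent_refutes:
  assumes "maximal_consistent Ag p\<^sub>0 \<Gamma>" "is_formula Ag \<phi>" "\<phi> \<notin> \<Gamma>"
  obtains \<chi>s where "set \<chi>s \<subseteq> \<Gamma>" "Syn Ag p\<^sub>0 (Imp (conj_list p\<^sub>0 \<chi>s) (Neg \<phi>))"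
proof -
  have "\<not> consistent Ag p\<^sub>0 (insert \<phi> \<Gamma>)"
    using assms by (auto simp: maximal_consistent_def)
  then obtain \<chi>s where \<chi>s: "set \<chi>s \<subseteq> insert \<phi> \<Gamma>" "Syn Ag p\<^sub>0 (Imp (conj_list p\<^sub>0 \<chi>s) (Bot p\<^sub>0))"
    using assms by (auto simp: consistent_def derives_def dest: maximal_consistent_is_formula)
  have fm: "\<forall>\<chi>\<in>set \<chi>s. is_formula Ag \<chi>"
    using \<chi>s(1) assms(2) maximal_consistent_is_formula[OF assms(1)] by blast
  show thesis
  proof
    \<comment> \<open>Filtering drops every occurrence of \<phi>. If there is none, the list already
      entails falsity and hence \<open>Neg \<phi>\<close>.\<close>
    show "set (filter (\<lambda>\<chi>. \<chi> \<noteq> \<phi>) \<chi>s) \<subseteq> \<Gamma>"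
      using \<chi>s(1) by auto
    show "Syn Ag p\<^sub>0 (Imp (conj_list p\<^sub>0 (filter (\<lambda>\<chi>. \<chi> \<noteq> \<phi>) \<chi>s)) (Neg \<phi>))"
      by (rule Syn_tautological_consequence[OF \<chi>s(2) \<chi>s(2)]) (use fm assms(2) in auto)
  qed
qed

text \<open>If \<phi> were missing, a list refuting it and a list deriving it could be appended into
  a derivation of falsity from \<Gamma>.\<close>

lemma maximal_consistent_closed:
  assumes \<Gamma>: "maximal_consistent Ag p\<^sub>0 \<Gamma>" and \<phi>: "is_formula Ag \<phi>"
    and d: "derives Ag p\<^sub>0 \<Gamma> \<phi>"
  shows "\<phi> \<in> \<Gamma>"
proof (rule ccontr)
  assume "\<phi> \<notin> \<Gamma>"
  then obtain \<chi>s where \<chi>s: "set \<chi>s \<subseteq> \<Gamma>" "Syn Ag p\<^sub>0 (Imp (conj_list p\<^sub>0 \<chi>s) (Neg \<phi>))"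
    using maximal_consistent_refutes[OF \<Gamma> \<phi>] by blast
  obtain \<psi>s where \<psi>s: "set \<psi>s \<subseteq> \<Gamma>" "Syn Ag p\<^sub>0 (Imp (conj_list p\<^sub>0 \<psi>s) \<phi>)"
    using d by (auto simp: derives_def)
  have fm: "\<forall>\<chi>\<in>set \<chi>s \<union> set \<psi>s. is_formula Ag \<chi>"
    using \<chi>s(1) \<psi>s(1) maximal_consistent_is_formula[OF \<Gamma>] by blast
  have "Syn Ag p\<^sub>0 (Imp (conj_list p\<^sub>0 (\<chi>s @ \<psi>s)) (Bot p\<^sub>0))"
    by (rule Syn_tautological_consequence[OF \<chi>s(2) \<psi>s(2)]) (use fm \<phi> in auto)
  moreover have "set (\<chi>s @ \<psi>s) \<subseteq> \<Gamma>"
    using \<chi>s(1) \<psi>s(1) by simp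
  ultimately have "derives Ag p\<^sub>0 \<Gamma> (Bot p\<^sub>0)"
    unfolding derives_def by blast
  then show False
    using \<Gamma> by (simp add: maximal_consistent_def consistent_def)
qed

text \<open>Tautologies are theorems, so propositional deductions inside \<Gamma> become truth-value
  checks on an explicit list of members.\<close>

lemma maximal_consistent_tautological_consequence:
  assumes \<Gamma>: "maximal_consistent Ag p\<^sub>0 \<Gamma>" and \<phi>: "is_formula Ag \<phi>" and \<psi>s: "set \<psi>s \<subseteq> \<Gamma>"
    and "\<And>v. \<forall>\<psi>\<in>set \<psi>s. prop_eval v \<psi> \<Longrightarrow> prop_eval v \<phi>"
  shows "\<phi> \<in> \<Gamma>"
proof (rule maximal_consistent_closed[OF \<Gamma> \<phi>])
  have "Syn Ag p\<^sub>0 (Imp (conj_list p\<^sub>0 \<psi>s) \<phi>)"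
    using assms maximal_consistent_is_formula[OF \<Gamma>] by (intro Syn.Taut) (auto simp: tautology_def)
  then show "derives Ag p\<^sub>0 \<Gamma> \<phi>"
    using \<psi>s by (auto simp: derives_def)
qed

lemma maximal_consistent_mp:
  assumes \<Gamma>: "maximal_consistent Ag p\<^sub>0 \<Gamma>" and "Imp \<phi> \<psi> \<in> \<Gamma>" "\<phi> \<in> \<Gamma>"
  shows "\<psi> \<in> \<Gamma>"
proof (rule maximal_consistent_tautological_consequence[OF \<Gamma>, where \<psi>s = "[Imp \<phi> \<psi>, \<phi>]"])
  show "is_formula Ag \<psi>"
    using maximal_consistent_is_formula[OF \<Gamma> assms(2)] by simp
qed (use assms in auto)

lemma maximal_consistent_Bot:
  "maximal_consistent Ag p\<^sub>0 \<Gamma> \<Longrightarrow> Bot p\<^sub>0 \<notin> \<Gamma>"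
proof
  assume \<Gamma>: "maximal_consistent Ag p\<^sub>0 \<Gamma>" and "Bot p\<^sub>0 \<in> \<Gamma>"
  moreover have "Syn Ag p\<^sub>0 (Imp (conj_list p\<^sub>0 [Bot p\<^sub>0]) (Bot p\<^sub>0))"
    by (intro Syn.Taut) (auto simp: tautology_def)
  ultimately have "derives Ag p\<^sub>0 \<Gamma> (Bot p\<^sub>0)"
    unfolding derives_def by (intro exI[of _ "[Bot p\<^sub>0]"]) simp
  then show False
    using \<Gamma> by (simp add: maximal_consistent_def consistent_def)
qed

lemma maximal_consistent_Neg:
  assumes \<Gamma>: "maximal_consistent Ag p\<^sub>0 \<Gamma>" and \<phi>: "is_formula Ag \<phi>"
  shows "Neg \<phi> \<in> \<Gamma> \<longleftrightarrow> \<phi> \<notin> \<Gamma>"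
proof
  show "\<phi> \<notin> \<Gamma>" if "Neg \<phi> \<in> \<Gamma>"
  proof
    assume "\<phi> \<in> \<Gamma>"
    then have "Bot p\<^sub>0 \<in> \<Gamma>"
      using that
      by (intro maximal_consistent_tautological_consequence[OF \<Gamma>, where \<psi>s = "[Neg \<phi>, \<phi>]"]) auto
    then show False
      using maximal_consistent_Bot[OF \<Gamma>] by simp
  qed
  \<comment> \<open>The list refuting \<phi> derives \<open>Neg \<phi>\<close> from \<Gamma>, and
    \<Gamma> is closed under derivation.\<close>
  show "Neg \<phi> \<in> \<Gamma>" if "\<phi> \<notin> \<Gamma>"
    using maximal_consistent_refutes[OF \<Gamma> \<phi> that] maximal_consistent_closed[OF \<Gamma>] \<phi>
    unfolding derives_def by (metis is_formula.simps(2))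
qed

lemma maximal_consistent_Conj:
  assumes \<Gamma>: "maximal_consistent Ag p\<^sub>0 \<Gamma>" and "\<phi> \<in> \<Gamma>" "\<psi> \<in> \<Gamma>"
  shows "Conj \<phi> \<psi> \<in> \<Gamma>"
  by (rule maximal_consistent_tautological_consequence[OF \<Gamma>, where \<psi>s = "[\<phi>, \<psi>]"])
    (use assms maximal_consistent_is_formula[OF \<Gamma>] in auto)

lemma maximal_consistent_conj_list:
  assumes \<Gamma>: "maximal_consistent Ag p\<^sub>0 \<Gamma>" and "set \<phi>s \<subseteq> \<Gamma>"
  shows "conj_list p\<^sub>0 \<phi>s \<in> \<Gamma>"
  by (rule maximal_consistent_tautological_consequence[OF \<Gamma>, where \<psi>s = \<phi>s])
    (use assms maximal_consistent_is_formula[OF \<Gamma>] in auto)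

lemma maximal_consistent_Disj:
  assumes \<Gamma>: "maximal_consistent Ag p\<^sub>0 \<Gamma>" and d: "Disj \<phi> \<psi> \<in> \<Gamma>"
  shows "\<phi> \<in> \<Gamma> \<or> \<psi> \<in> \<Gamma>"
proof (rule ccontr)
  assume neither: "\<not> (\<phi> \<in> \<Gamma> \<or> \<psi> \<in> \<Gamma>)"
  have fm: "is_formula Ag \<phi>" "is_formula Ag \<psi>"
    using maximal_consistent_is_formula[OF \<Gamma> d] by (auto simp: Disj_def)
  then have "Conj (Neg \<phi>) (Neg \<psi>) \<in> \<Gamma>"
    using neither by (intro maximal_consistent_Conj[OF \<Gamma>]) (auto simp: maximal_consistent_Neg[OF \<Gamma>])
  then show False
    using d fm maximal_consistent_Neg[OF \<Gamma>, of "Conj (Neg \<phi>) (Neg \<psi>)"] by (simp add: Disj_def)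
qed

text \<open>Primeness iterated along the list; the empty disjunction is falsity, which is never a
  member. This extracts an alive pattern from axiom \<open>NE\<close>.\<close>

lemma maximal_consistent_disj_list:
  assumes \<Gamma>: "maximal_consistent Ag p\<^sub>0 \<Gamma>" and "disj_list p\<^sub>0 \<phi>s \<in> \<Gamma>"
  shows "\<exists>\<phi>\<in>set \<phi>s. \<phi> \<in> \<Gamma>"
  using assms(2)
proof (induction \<phi>s)
  case Nil
  then show ?case
    using maximal_consistent_Bot[OF \<Gamma>] by (simp add: disj_list_def)
next
  case (Cons \<phi> \<phi>s)
  then show ?case
    using maximal_consistent_Disj[OF \<Gamma>, of \<phi> "disj_list p\<^sub>0 \<phi>s"] by (auto simp: disj_list_def)
qed

text \<open>A theorem is derivable from the empty list of premises. Through this every axiom becomes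
  available inside every world.\<close>

lemma maximal_consistent_Syn:
  assumes "finite Ag" "maximal_consistent Ag p\<^sub>0 \<Gamma>" "Syn Ag p\<^sub>0 \<phi>"
  shows "\<phi> \<in> \<Gamma>"
proof (rule maximal_consistent_closed[OF assms(2)])
  show \<phi>: "is_formula Ag \<phi>"
    by (rule Syn_is_formula[OF assms(1,3)])
  have "Syn Ag p\<^sub>0 (Imp (conj_list p\<^sub>0 []) \<phi>)"
    by (rule Syn_tautological_consequence[OF assms(3,3)]) (use \<phi> in auto)
  then show "derives Ag p\<^sub>0 \<Gamma> \<phi>"
    unfolding derives_def by (intro exI[of _ "[]"]) simp
qed

lemma maximal_consistent_Syn_mp:
  assumes "finite Ag" "maximal_consistent Ag p\<^sub>0 \<Gamma>" "Syn Ag p\<^sub>0 (Imp \<phi> \<psi>)" "\<phi> \<in> \<Gamma>"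
  shows "\<psi> \<in> \<Gamma>"
  using maximal_consistent_mp[OF assms(2) maximal_consistent_Syn[OF assms(1-3)] assms(4)] .

lemma maximal_consistent_subset_eq:
  assumes "maximal_consistent Ag p\<^sub>0 \<Gamma>" "maximal_consistent Ag p\<^sub>0 \<Delta>" "\<Gamma> \<subseteq> \<Delta>"
  shows "\<Gamma> = \<Delta>"
  using assms by (auto simp: maximal_consistent_def)

section \<open>The relations of the canonical model\<close>

lemma worlds_canonical [simp]:
  "\<Gamma> \<in> worlds (canonical_model Ag p\<^sub>0) \<longleftrightarrow> maximal_consistent Ag p\<^sub>0 \<Gamma>"
  by (simp add: canonical_model_def)

lemma indist_canonical:
  "(\<Gamma>, \<Delta>) \<in> indist (canonical_model Ag p\<^sub>0) G \<longleftrightarrow>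
     maximal_consistent Ag p\<^sub>0 \<Gamma> \<and> maximal_consistent Ag p\<^sub>0 \<Delta> \<and> (\<forall>\<phi>. Box G \<phi> \<in> \<Gamma> \<longrightarrow> \<phi> \<in> \<Delta>)"
  by (auto simp: canonical_model_def)

text \<open>Axiom \<open>B\<close> read contrapositively: if \<phi> is boxed in \<Delta> but missing
  from \<Gamma>, then \<open>B\<close> applied to \<open>Neg \<phi>\<close> in \<Gamma> puts into
  \<Delta> a formula denying that \<phi> is boxed there.\<close>

lemma sym_indist_canonical:
  assumes "finite Ag" and G: "agent_pattern Ag G"
  shows "sym (indist (canonical_model Ag p\<^sub>0) G)"
proof (rule symI)
  fix \<Gamma> \<Delta>
  assume "(\<Gamma>, \<Delta>) \<in> indist (canonical_model Ag p\<^sub>0) G"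
  then have \<Gamma>: "maximal_consistent Ag p\<^sub>0 \<Gamma>" and \<Delta>: "maximal_consistent Ag p\<^sub>0 \<Delta>"
    and sub: "\<And>\<phi>. Box G \<phi> \<in> \<Gamma> \<Longrightarrow> \<phi> \<in> \<Delta>"
    by (auto simp: indist_canonical)
  have "\<phi> \<in> \<Gamma>" if box: "Box G \<phi> \<in> \<Delta>" for \<phi>
  proof (rule ccontr)
    assume "\<phi> \<notin> \<Gamma>"
    have \<phi>: "is_formula Ag \<phi>"
      using maximal_consistent_is_formula[OF \<Delta> box] by simp
    then have "Neg \<phi> \<in> \<Gamma>"
      using \<open>\<phi> \<notin> \<Gamma>\<close> by (simp add: maximal_consistent_Neg[OF \<Gamma>])
    then have "Box G (Neg (Box G (Neg (Neg \<phi>)))) \<in> \<Gamma>"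
      using Syn.B[OF G, of "Neg \<phi>"] \<phi> maximal_consistent_Syn_mp[OF assms(1) \<Gamma>]
      by (metis is_formula.simps(2))
    then have "Neg (Box G (Neg (Neg \<phi>))) \<in> \<Delta>"
      by (rule sub)
    \<comment> \<open>The instance of \<open>B\<close> mentions \<open>Neg (Neg \<phi>)\<close>,
      which differs syntactically from \<phi>, so the double negation is introduced under the box
      before the clash.\<close>
    moreover have "Syn Ag p\<^sub>0 (Imp (Box G \<phi>) (Box G (Neg (Neg \<phi>))))"
      using G \<phi> by (intro Syn_Box_mono Syn.Taut) (auto simp: tautology_def)
    then have "Box G (Neg (Neg \<phi>)) \<in> \<Delta>"
      using maximal_consistent_Syn_mp[OF assms(1) \<Delta>] box by blast
    ultimately show False
      using G \<phi> by (simp add: maximal_consistent_Neg[OF \<Delta>])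
  qed
  then show "(\<Delta>, \<Gamma>) \<in> indist (canonical_model Ag p\<^sub>0) G"
    using \<Gamma> \<Delta> by (simp add: indist_canonical)
qed

text \<open>Axiom \<open>Four\<close> doubles the box, and each of the two steps consumes one
  layer.\<close>

lemma trans_indist_canonical:
  assumes "finite Ag" and G: "agent_pattern Ag G"
  shows "trans (indist (canonical_model Ag p\<^sub>0) G)"
proof (rule transI)
  fix \<Gamma> \<Delta> \<Theta>
  assume *: "(\<Gamma>, \<Delta>) \<in> indist (canonical_model Ag p\<^sub>0) G" "(\<Delta>, \<Theta>) \<in> indist (canonical_model Ag p\<^sub>0) G"
  then have \<Gamma>: "maximal_consistent Ag p\<^sub>0 \<Gamma>"
    by (simp add: indist_canonical)
  have "Box G (Box G \<phi>) \<in> \<Gamma>" if "Box G \<phi> \<in> \<Gamma>" for \<phi>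
    using maximal_consistent_is_formula[OF \<Gamma> that]
      maximal_consistent_Syn_mp[OF assms(1) \<Gamma> Syn.Four that] by simp
  then show "(\<Gamma>, \<Theta>) \<in> indist (canonical_model Ag p\<^sub>0) G"
    using * by (auto simp: indist_canonical)
qed

lemma indist_canonical_refl_iff:
  assumes "finite Ag" and G: "agent_pattern Ag G"
  shows "(\<Gamma>, \<Gamma>) \<in> indist (canonical_model Ag p\<^sub>0) G \<longleftrightarrow>
    maximal_consistent Ag p\<^sub>0 \<Gamma> \<and> alive p\<^sub>0 G \<in> \<Gamma>"
proof (cases "maximal_consistent Ag p\<^sub>0 \<Gamma>")
  case \<Gamma>: True
  show ?thesis
  proof
    assume "(\<Gamma>, \<Gamma>) \<in> indist (canonical_model Ag p\<^sub>0) G"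
    then have "Box G (Bot p\<^sub>0) \<notin> \<Gamma>"
      using maximal_consistent_Bot[OF \<Gamma>] by (auto simp: indist_canonical)
    then show "maximal_consistent Ag p\<^sub>0 \<Gamma> \<and> alive p\<^sub>0 G \<in> \<Gamma>"
      using \<Gamma> G by (simp add: alive_def maximal_consistent_Neg[OF \<Gamma>])
  next
    assume alive: "maximal_consistent Ag p\<^sub>0 \<Gamma> \<and> alive p\<^sub>0 G \<in> \<Gamma>"
    have "\<phi> \<in> \<Gamma>" if box: "Box G \<phi> \<in> \<Gamma>" for \<phi>
    proof -
      have "Syn Ag p\<^sub>0 (Imp (alive p\<^sub>0 G) (Imp (Box G \<phi>) \<phi>))"
        using maximal_consistent_is_formula[OF \<Gamma> box] by (intro Syn.T) simp_all
      then show ?thesis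
        using maximal_consistent_Syn_mp[OF assms(1) \<Gamma>] maximal_consistent_mp[OF \<Gamma>] alive box
        by blast
    qed
    then show "(\<Gamma>, \<Gamma>) \<in> indist (canonical_model Ag p\<^sub>0) G"
      using \<Gamma> by (simp add: indist_canonical)
  qed
qed (simp add: indist_canonical)

lemma alive_worlds_canonical:
  assumes "finite Ag" "agent_pattern Ag G"
  shows "\<Gamma> \<in> alive_worlds (canonical_model Ag p\<^sub>0) G \<longleftrightarrow>
    maximal_consistent Ag p\<^sub>0 \<Gamma> \<and> alive p\<^sub>0 G \<in> \<Gamma>"
  by (auto simp: alive_worlds_def indist_canonical_refl_iff[OF assms])

text \<open>Boxes and relations are contravariant: when \<open>Box G\<close> implies
  \<open>Box H\<close>, an \<open>H\<close>-successor contains everything boxed by \<open>G\<close>.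
  Axioms \<open>Mono\<close> and \<open>Equiv\<close> both become frame conditions in this
  way.\<close>

lemma indist_canonical_mono:
  assumes "finite Ag"
    and "\<And>\<phi>. agent_pattern Ag G \<Longrightarrow> is_formula Ag \<phi> \<Longrightarrow> Syn Ag p\<^sub>0 (Imp (Box G \<phi>) (Box H \<phi>))"
  shows "indist (canonical_model Ag p\<^sub>0) H \<subseteq> indist (canonical_model Ag p\<^sub>0) G"
proof (rule subrelI)
  fix \<Gamma> \<Delta>
  assume *: "(\<Gamma>, \<Delta>) \<in> indist (canonical_model Ag p\<^sub>0) H"
  then have \<Gamma>: "maximal_consistent Ag p\<^sub>0 \<Gamma>"
    by (simp add: indist_canonical)
  have "Box H \<phi> \<in> \<Gamma>" if "Box G \<phi> \<in> \<Gamma>" for \<phi>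
    using maximal_consistent_is_formula[OF \<Gamma> that]
      maximal_consistent_Syn_mp[OF assms(1) \<Gamma> assms(2) that] by simp
  then show "(\<Gamma>, \<Delta>) \<in> indist (canonical_model Ag p\<^sub>0) G"
    using * by (auto simp: indist_canonical)
qed

section \<open>The frame conditions of a kappa-model\<close>

lemma kappa_model_canonical:
  fixes Ag :: "'a set" and p\<^sub>0 :: 'p
  assumes fin: "finite Ag"
  shows "kappa_model Ag (canonical_model Ag p\<^sub>0)"
proof -
  let ?M = "canonical_model Ag p\<^sub>0"
  have "pre_model Ag ?M"
    unfolding pre_model_def
    by (intro conjI allI impI sym_indist_canonical[OF fin] trans_indist_canonical[OF fin])
      (auto simp: canonical_model_def)
  moreover have "alive_worlds ?M G \<inter> alive_worlds ?M H \<subseteq> alive_worlds ?M (G \<union> H)"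
    if G: "agent_pattern Ag G" and H: "agent_pattern Ag H" for G H
    using maximal_consistent_Syn_mp[OF fin _ Syn.Union[OF G H] maximal_consistent_Conj]
    by (auto simp: alive_worlds_canonical[OF fin] G H)
  moreover have "alive_worlds ?M G \<subseteq> alive_worlds ?M {A \<union> B}"
    if G: "agent_pattern Ag G" and AB: "A \<in> G" "B \<in> G" for G A B
  proof -
    have "agent_pattern Ag {A \<union> B}"
      using G AB by (auto simp: agent_pattern_def)
    then show ?thesis
      using maximal_consistent_Syn_mp[OF fin _ Syn.Clo[OF G AB]]
      by (auto simp: alive_worlds_canonical[OF fin] G)
  qed
  moreover have "indist ?M H \<subseteq> indist ?M G"
    if "agent_pattern Ag G" "agent_pattern Ag H" "G \<subseteq> H" for G H
    using that by (intro indist_canonical_mono[OF fin] Syn.Mono)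
  moreover have "indist ?M G \<subseteq> indist ?M (G \<union> {B})"
    if G: "agent_pattern Ag G" and B: "\<exists>A\<in>G. B \<noteq> {} \<and> B \<subseteq> A" for G B
  \<comment> \<open>The larger pattern \<open>G \<union> {B}\<close> is the antecedent box, which is
    the direction of axiom \<open>Equiv\<close>.\<close>
  proof (rule indist_canonical_mono[OF fin])
    obtain A where A: "A \<in> G" "B \<noteq> {}" "B \<subseteq> A"
      using B by blast
    fix \<phi> :: "('a, 'p) fm"
    assume "is_formula Ag \<phi>"
    then show "Syn Ag p\<^sub>0 (Imp (Box (G \<union> {B}) \<phi>) (Box G \<phi>))"
      using G A by (intro Syn.Equiv)
  qed
  moreover have "\<exists>G. agent_pattern Ag G \<and> (\<Gamma>, \<Gamma>) \<in> indist ?M G" if "\<Gamma> \<in> worlds ?M" for \<Gamma>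
  proof -
    have \<Gamma>: "maximal_consistent Ag p\<^sub>0 \<Gamma>"
      using that by simp
    show ?thesis
      \<comment> \<open>Some disjunct \<open>alive p\<^sub>0 G\<close> of axiom \<open>NE\<close>
        lies in \<Gamma>, which means that \<Gamma> is related to itself by
        \<open>G\<close>.\<close>
      using maximal_consistent_disj_list[OF \<Gamma> maximal_consistent_Syn[OF fin \<Gamma> Syn.NE]] \<Gamma>
      by (auto simp: set_enumeration finite_agent_patterns[OF fin] indist_canonical_refl_iff[OF fin])
  qed
  ultimately show ?thesis
    unfolding kappa_model_def by (intro conjI allI impI ballI) simp_all
qed

section \<open>Patterns of worlds and properness\<close>

lemma agent_pattern_alive_sets: "agent_pattern Ag (alive_sets Ag M w)"
  by (auto simp: alive_sets_def agent_pattern_def)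

lemma dead_compl_alive_sets_canonical:
  assumes fin: "finite Ag" and \<Gamma>: "maximal_consistent Ag p\<^sub>0 \<Gamma>"
  shows "dead p\<^sub>0 (pattern_compl Ag (alive_sets Ag (canonical_model Ag p\<^sub>0) \<Gamma>)) \<in> \<Gamma>"
proof -
  let ?D = "alive_sets Ag (canonical_model Ag p\<^sub>0) \<Gamma>"
  have "Neg (alive p\<^sub>0 {B}) \<in> \<Gamma>" if B: "B \<in> pattern_compl Ag ?D" for B
  proof -
    \<comment> \<open>Since \<open>B \<subseteq> B\<close>, a member of the complement is not in
      \<open>?D\<close>; were \<open>alive p\<^sub>0 {B}\<close> in \<Gamma>, the pattern
      \<open>{B}\<close> would witness that it is.\<close>
    have pat: "agent_pattern Ag {B}" and "B \<notin> ?D"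
      using B by (auto simp: pattern_compl_def agent_pattern_def)
    then have "alive p\<^sub>0 {B} \<notin> \<Gamma>"
      using \<Gamma> alive_worlds_canonical[OF fin pat, of \<Gamma> p\<^sub>0] by (auto simp: alive_sets_def)
    then show ?thesis
      using pat by (simp add: maximal_consistent_Neg[OF \<Gamma>])
  qed
  then show ?thesis
    unfolding dead_def
    by (intro maximal_consistent_conj_list[OF \<Gamma>])
      (auto simp: set_enumeration finite_pattern_compl[OF fin])
qed

lemma proper_canonical:
  assumes fin: "finite Ag"
  shows "proper Ag (canonical_model Ag p\<^sub>0)"
  unfolding proper_def
proof (intro ballI impI)
  let ?M = "canonical_model Ag p\<^sub>0"
  fix \<Gamma> \<Delta>
  assume "\<Gamma> \<in> worlds ?M" "\<Delta> \<in> worlds ?M" and equiv: "world_equiv Ag ?M \<Gamma> \<Delta>"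
  then have \<Gamma>: "maximal_consistent Ag p\<^sub>0 \<Gamma>" and \<Delta>: "maximal_consistent Ag p\<^sub>0 \<Delta>"
    by simp_all
  define D where "D = alive_sets Ag ?M \<Gamma>"
  let ?dead = "dead p\<^sub>0 (pattern_compl Ag D)"
  have D: "agent_pattern Ag D"
    by (simp add: D_def agent_pattern_alive_sets)
  have rel: "(\<Gamma>, \<Delta>) \<in> indist ?M D" and D': "D = alive_sets Ag ?M \<Delta>"
    using equiv by (auto simp: world_equiv_def D_def)
  \<comment> \<open>It is literally one formula in both worlds, because they have the same pattern
    \<open>D\<close>.\<close>
  have dead: "?dead \<in> \<Gamma>" "?dead \<in> \<Delta>"
    using dead_compl_alive_sets_canonical[OF fin \<Gamma>] dead_compl_alive_sets_canonical[OF fin \<Delta>]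
    by (simp_all add: D_def[symmetric] D'[symmetric])
  \<comment> \<open>A symmetric and transitive relation is reflexive at any point that has a
    successor; here the successor is \<Delta>.\<close>
  have "(\<Gamma>, \<Gamma>) \<in> indist ?M D"
    using rel sym_indist_canonical[OF fin D] trans_indist_canonical[OF fin D] by (meson symD transD)
  then have alive: "alive p\<^sub>0 D \<in> \<Gamma>"
    by (simp add: indist_canonical_refl_iff[OF fin D])
  have "\<Gamma> \<subseteq> \<Delta>"
  proof
    fix \<phi>
    assume \<phi>: "\<phi> \<in> \<Gamma>"
    have "Conj (alive p\<^sub>0 D) (Conj ?dead \<phi>) \<in> \<Gamma>"
      by (intro maximal_consistent_Conj[OF \<Gamma>] alive dead \<phi>)
    then have "Box D (Imp ?dead \<phi>) \<in> \<Gamma>"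
      using maximal_consistent_Syn_mp[OF fin \<Gamma> Syn.P[OF D maximal_consistent_is_formula[OF \<Gamma> \<phi>]]]
      by simp
    \<comment> \<open>Axiom \<open>P\<close> transports \<phi> only under the guard
      \<open>?dead\<close>; membership of the guard in \<Delta> then releases \<phi>.\<close>
    then have "Imp ?dead \<phi> \<in> \<Delta>"
      using rel by (simp add: indist_canonical)
    then show "\<phi> \<in> \<Delta>"
      using maximal_consistent_mp[OF \<Delta>] dead(2) by blast
  qed
  then show "\<Gamma> = \<Delta>"
    by (rule maximal_consistent_subset_eq[OF \<Gamma> \<Delta>])
qed

theorem theorem5p45:
  fixes Ag :: "'a set" and p\<^sub>0 :: "'p::countable"
  assumes "finite Ag"
  shows "kappa_model Ag (canonical_model Ag p\<^sub>0) \<and> proper Ag (canonical_model Ag p\<^sub>0)"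
  by (intro conjI kappa_model_canonical proper_canonical assms)

end
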